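(* Let $\delta, K, C$ be positive integers such that $\delta\geq 2$, $1\leq K\leq \delta$ and $2\delta+K<C\leq 3\delta+1$. Then the class $\mathcal A^\delta_{K,C}$ has the extension property for partial automorphisms (EPPA): for every $\mathbf A\in\mathcal A^\delta_{K,C}$ there is $\mathbf B\in\mathcal A^\delta_{K,C}$ such that $\mathbf A$ is a subspace of $\mathbf B$ and every partial automorphism of $\mathbf A$ extends to an automorphism of $\mathbf B$.
   Context: For positive integers $\delta,K,C$, $\mathcal A^\delta_{K,C}$ denotes the class of all finite metric spaces $\mathbf M=(M,d)$ with integer distances such that: (i) $d(x,y)\leq\delta$ for all $x,y\in M$; (ii) the perimeter of every triangle is less than $C$; (iii) if a triangle has odd perimeter, then its perimeter is at least $2K+1$. Here a triangle is any triple of distinct points $u,v,w\in M$, and its perimeter is $d(u,v)+d(v,w)+d(w,u)$. A partial automorphism of a metric space $\mathbf A$ is an isometry (bijective distance-preserving map) $f\colon \mathbf H\to\mathbf H'$ between two subspaces $\mathbf H,\mathbf H'$ of $\mathbf A$. An automorphism of $\mathbf B$ is an isometry of $\mathbf B$ onto itself. *)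

theory Defs
  imports "HOL-Analysis.Analysis" "HOL-Library.Infinite_Typeclass"
begin

definition perimeter :: "'a metric \<Rightarrow> 'a \<Rightarrow> 'a \<Rightarrow> 'a \<Rightarrow> real" where
  "perimeter M u v w = mdist M u v + mdist M v w + mdist M w u"

definition triangle_in :: "'a metric \<Rightarrow> 'a \<Rightarrow> 'a \<Rightarrow> 'a \<Rightarrow> bool" where
  "triangle_in M u v w \<longleftrightarrow>
     u \<in> mspace M \<and> v \<in> mspace M \<and> w \<in> mspace M \<and> u \<noteq> v \<and> v \<noteq> w \<and> w \<noteq> u"

(* Distances are real-valued in the type of metrics; the parity of a perimeter is that of
   the integer p it equals. *)
definition metric_class :: "nat \<Rightarrow> nat \<Rightarrow> nat \<Rightarrow> 'a metric set" where
  "metric_class \<delta> K C = {M. finite (mspace M) \<and>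
     (\<forall>x\<in>mspace M. \<forall>y\<in>mspace M. mdist M x y \<in> \<int>) \<and>
     (\<forall>x\<in>mspace M. \<forall>y\<in>mspace M. mdist M x y \<le> real \<delta>) \<and>
     (\<forall>u v w. triangle_in M u v w \<longrightarrow> perimeter M u v w < real C) \<and>
     (\<forall>u v w. \<forall>p::int. triangle_in M u v w \<and> perimeter M u v w = of_int p \<and> odd p
        \<longrightarrow> 2 * int K + 1 \<le> p)}"

(* The distance function of a metric is a total function whose values outside the carrier
   carry no meaning, so it is only compared on the carrier of the smaller space. *)
definition is_metric_subspace :: "'a metric \<Rightarrow> 'a metric \<Rightarrow> bool" where
  "is_metric_subspace A B \<longleftrightarrow> mspace A \<subseteq> mspace B \<and>
     (\<forall>x\<in>mspace A. \<forall>y\<in>mspace A. mdist A x y = mdist B x y)"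

definition metric_isometry :: "'a metric \<Rightarrow> 'b metric \<Rightarrow> ('a \<Rightarrow> 'b) \<Rightarrow> bool" where
  "metric_isometry M N f \<longleftrightarrow> bij_betw f (mspace M) (mspace N) \<and>
     (\<forall>x\<in>mspace M. \<forall>y\<in>mspace M. mdist N (f x) (f y) = mdist M x y)"

definition partial_automorphism :: "'a metric \<Rightarrow> 'a set \<Rightarrow> 'a set \<Rightarrow> ('a \<Rightarrow> 'a) \<Rightarrow> bool" where
  "partial_automorphism A H H' f \<longleftrightarrow> H \<subseteq> mspace A \<and> H' \<subseteq> mspace A \<and>
     metric_isometry (submetric A H) (submetric A H') f"

definition metric_automorphism :: "'a metric \<Rightarrow> ('a \<Rightarrow> 'a) \<Rightarrow> bool" where
  "metric_automorphism B g \<longleftrightarrow> metric_isometry B B g"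

(* Only meaningful as EPPA when the ambient type is infinite: otherwise there need not be
   room for the points that have to be added to A. *)
definition has_EPPA :: "'a metric set \<Rightarrow> bool" where
  "has_EPPA \<A> \<longleftrightarrow>
     (\<forall>A\<in>\<A>. \<exists>B\<in>\<A>. is_metric_subspace A B \<and>
        (\<forall>H H' f. partial_automorphism A H H' f \<longrightarrow>
           (\<exists>g. metric_automorphism B g \<and> (\<forall>x\<in>H. g x = f x))))"

end

theory Submission
  imports Defs
begin

text \<open>Put \<open>c = C - 1\<close>. A triangle satisfies the triangle inequality and has perimeter at most \<open>c\<close>
  exactly if its antipodal double cover is metric; there an edge of length \<open>d\<close> becomes an edge of
  length \<open>c/2 - d\<close> when it changes the sheet. Hence a graph with edge labels in \<open>{1..\<delta>}\<close> can be
  completed, canonically, as soon as no closed walk is bad: a closed walk is bad if it has a lift of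
  length less than \<open>c/2\<close> that joins the two points of a fibre, or if its length is odd and less
  than \<open>2 * K + 1\<close>. The completed distance is the admissible value closest to
  \<open>M = \<lfloor>(c - \<delta>) / 2\<rfloor>\<close>.

  Bad closed walks have at most \<open>c\<close> edges, and a chord splits a bad closed walk into two closed walks,
  one of which is bad. A finite graph that extends all partial automorphisms of the given space and has
  no bad closed walk with at most \<open>n\<close> edges is obtained by induction on \<open>n\<close>, following the valuation
  construction of Hubicka, Konecny and Nesetril: each point is equipped with one bit for every
  bad cycle of length \<open>n + 1\<close> through it, in such a way that these cycles no longer lift.\<close>

subsection \<open>Killing bad closed walks\<close>

fun walk :: "('v \<Rightarrow> 'v \<Rightarrow> 'l \<Rightarrow> bool) \<Rightarrow> 'v \<Rightarrow> ('l \<times> 'v) list \<Rightarrow> 'v \<Rightarrow> bool" where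
  "walk E x [] y \<longleftrightarrow> x = y"
| "walk E x ((l, z) # p) y \<longleftrightarrow> E x z l \<and> walk E z p y"

lemma walk_append: "walk E x (p @ q) y \<longleftrightarrow> (\<exists>z. walk E x p z \<and> walk E z q y)"
  by (induction p arbitrary: x) auto

lemma walk_end_in: "walk E x p y \<Longrightarrow> p \<noteq> [] \<Longrightarrow> y \<in> snd ` set p"
  by (induction p arbitrary: x) (auto, metis list.set_intros(1) neq_Nil_conv walk.simps(1))

lemma walk_split_at:
  assumes "walk E x p y" "z \<in> snd ` set p"
  obtains q r where "p = q @ r" "q \<noteq> []" "walk E x q z" "walk E z r y"
proof -
  from assms(2) obtain l where "(l, z) \<in> set p" by auto
  then obtain q r where p: "p = q @ (l, z) # r" by (meson split_list)
  show thesis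
    by (rule that[of "q @ [(l, z)]" r]) (use assms(1) p in \<open>auto simp: walk_append\<close>)
qed

lemma walk_map:
  assumes "\<And>a b l. E a b l \<Longrightarrow> E' (g a) (g b) l" "walk E x p y"
  shows "walk E' (g x) (map (apsnd g) p) (g y)"
  using assms(2) by (induction p arbitrary: x) (auto intro: assms(1))

lemma walk_labels_vertices:
  assumes "\<And>x y l. E x y l \<Longrightarrow> y \<in> V \<and> l \<in> L" "walk E x p y"
  shows "set p \<subseteq> L \<times> V"
  using assms(2)
proof (induction p arbitrary: x)
  case (Cons a p)
  then show ?case using assms(1) by (cases a) fastforce
qed simp

lemma walk_reverse:
  assumes "\<And>x y l. E x y l \<Longrightarrow> E y x l" "walk E x p y"
  shows "\<exists>q. walk E y q x \<and> map fst q = rev (map fst p)"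
  using assms(2)
proof (induction p arbitrary: x)
  case (Cons a p)
  obtain l z where a: "a = (l, z)" by (cases a)
  with Cons obtain q where q: "walk E y q z" "map fst q = rev (map fst p)" by auto
  have "walk E y (q @ [(l, x)]) x"
    using q Cons.prems a assms(1) by (auto simp: walk_append)
  then show ?case using q a by (intro exI[of _ "q @ [(l, x)]"]) auto
qed auto

definition graph_aut :: "'v set \<Rightarrow> ('v \<Rightarrow> 'v \<Rightarrow> 'l \<Rightarrow> bool) \<Rightarrow> ('v \<Rightarrow> 'v) \<Rightarrow> bool" where
  "graph_aut V E g \<longleftrightarrow> bij_betw g V V \<and> (\<forall>x\<in>V. \<forall>y\<in>V. \<forall>l. E (g x) (g y) l \<longleftrightarrow> E x y l)"

lemma graph_aut_inv:
  assumes "graph_aut V E g"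
  shows "graph_aut V E (inv_into V g)"
proof -
  have bij: "bij_betw g V V" and E: "\<And>x y l. x \<in> V \<Longrightarrow> y \<in> V \<Longrightarrow> E (g x) (g y) l \<longleftrightarrow> E x y l"
    using assms unfolding graph_aut_def by auto
  have *: "inv_into V g x \<in> V" "g (inv_into V g x) = x" if "x \<in> V" for x
    using bij that by (auto simp: bij_betw_def f_inv_into_f intro: inv_into_into)
  show ?thesis
    unfolding graph_aut_def using bij_betw_inv_into[OF bij] * E by metis
qed

lemma partial_injection_extends:
  assumes "finite A" "H \<subseteq> A" "inj_on f H" "f ` H \<subseteq> A"
  obtains g where "bij_betw g A A" "\<And>x. x \<in> H \<Longrightarrow> g x = f x"
proof -
  have "card (A - H) = card (A - f ` H)"
    using assms by (simp add: card_Diff_subset card_image finite_subset)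
  then obtain k where k: "bij_betw k (A - H) (A - f ` H)"
    using assms(1) finite_same_card_bij by (metis finite_Diff)
  let ?g = "\<lambda>x. if x \<in> H then f x else k x"
  have "bij_betw ?g (H \<union> (A - H)) (f ` H \<union> (A - f ` H))"
  proof (rule bij_betw_combine)
    show "bij_betw ?g H (f ` H)"
      using assms(3) by (auto simp: bij_betw_def inj_on_def)
    show "bij_betw ?g (A - H) (A - f ` H)"
      using k by (rule bij_betw_cong[THEN iffD1, rotated]) auto
  qed auto
  then have "bij_betw ?g A A"
    using assms by (simp add: Un_absorb1)
  then show thesis by (rule that) auto
qed

section \<open>Abstract bad words and graphs with the extension property\<close>

text \<open>The edge relations are allowed to put several labels on a pair of points. Two labels on one
  pair form a bad closed walk of length 2 in the application, so they disappear eventually.\<close>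

locale bad_words =
  fixes bad :: "'l list \<Rightarrow> bool" and L :: "'l set"
    and A :: "'a set" and d :: "'a \<Rightarrow> 'a \<Rightarrow> 'l"
  assumes finite_L: "finite L"
    and bad_append: "bad (u @ w) \<Longrightarrow> bad u \<or> bad w"
    and bad_chord: "bad (u @ w) \<Longrightarrow> l \<in> L \<Longrightarrow> bad (u @ [l]) \<or> bad (w @ [l])"
    and bad_commute: "bad (u @ w) \<Longrightarrow> bad (w @ u)"
    and not_bad_Nil: "\<not> bad []"
    and not_bad_pair: "\<not> bad [l, l]"
    and finite_A: "finite A"
    and d_in_L: "\<lbrakk>x \<in> A; y \<in> A; x \<noteq> y\<rbrakk> \<Longrightarrow> d x y \<in> L"
    and d_commute: "d x y = d y x"
    and not_bad_triangle:
      "\<lbrakk>x \<in> A; y \<in> A; z \<in> A; x \<noteq> y; y \<noteq> z; z \<noteq> x\<rbrakk> \<Longrightarrow> \<not> bad [d x y, d y z, d z x]"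
begin

text \<open>The induction invariant: only closed walks with at most \<open>n\<close> edges are
  controlled. The vertex type is free because the cover lives on pairs.\<close>

definition eppa_graph ::
    "nat \<Rightarrow> 'v set \<Rightarrow> ('v \<Rightarrow> 'v \<Rightarrow> 'l \<Rightarrow> bool) \<Rightarrow> ('a \<Rightarrow> 'v) \<Rightarrow> bool" where
  "eppa_graph n V E \<iota> \<longleftrightarrow> finite V \<and> \<iota> ` A \<subseteq> V \<and> inj_on \<iota> A \<and>
     (\<forall>x y l. E x y l \<longrightarrow> x \<in> V \<and> y \<in> V \<and> x \<noteq> y \<and> l \<in> L \<and> E y x l) \<and>
     (\<forall>x\<in>A. \<forall>y\<in>A. x \<noteq> y \<longrightarrow> E (\<iota> x) (\<iota> y) (d x y)) \<and>
     (\<forall>x p. walk E x p x \<longrightarrow> length p \<le> n \<longrightarrow> \<not> bad (map fst p)) \<and>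
     (\<forall>H f. H \<subseteq> A \<longrightarrow> inj_on f H \<longrightarrow> f ` H \<subseteq> A \<longrightarrow> (\<forall>x\<in>H. \<forall>y\<in>H. d (f x) (f y) = d x y) \<longrightarrow>
       (\<exists>g. graph_aut V E g \<and> (\<forall>x\<in>H. g (\<iota> x) = \<iota> (f x))))"

text \<open>With every label on every pair, each permutation of \<open>A\<close> is an automorphism;
  without loops, a closed walk with at most one edge is empty.\<close>

lemma eppa_graph_base:
  "eppa_graph 1 A (\<lambda>x y l. x \<in> A \<and> y \<in> A \<and> x \<noteq> y \<and> l \<in> L) (\<lambda>x. x)"
proof -
  let ?E = "\<lambda>x y l. x \<in> A \<and> y \<in> A \<and> x \<noteq> y \<and> l \<in> L"
  have "\<not> bad (map fst p)" if "walk ?E x p x" "length p \<le> 1" for x p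
    using that not_bad_Nil by (cases p) auto
  moreover have "\<exists>g. graph_aut A ?E g \<and> (\<forall>x\<in>H. g x = f x)"
    if "H \<subseteq> A" "inj_on f H" "f ` H \<subseteq> A" for H f
  proof -
    obtain g where g: "bij_betw g A A" "\<And>x. x \<in> H \<Longrightarrow> g x = f x"
      using partial_injection_extends[OF finite_A \<open>H \<subseteq> A\<close> \<open>inj_on f H\<close> \<open>f ` H \<subseteq> A\<close>] by blast
    have "graph_aut A ?E g"
      unfolding graph_aut_def using g(1) by (auto simp: bij_betw_def inj_on_def)
    with g(2) show ?thesis by auto
  qed
  ultimately show ?thesis
    unfolding eppa_graph_def using finite_A d_in_L by auto
qed

lemma eppa_graphD:
  assumes "eppa_graph n V E \<iota>"
  shows "finite V" "\<iota> ` A \<subseteq> V" "inj_on \<iota> A"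
    and "E x y l \<Longrightarrow> x \<in> V \<and> y \<in> V \<and> x \<noteq> y \<and> l \<in> L \<and> E y x l"
    and "a \<in> A \<Longrightarrow> b \<in> A \<Longrightarrow> a \<noteq> b \<Longrightarrow> E (\<iota> a) (\<iota> b) (d a b)"
    and "walk E x p x \<Longrightarrow> length p \<le> n \<Longrightarrow> \<not> bad (map fst p)"
  using assms unfolding eppa_graph_def by (elim conjE; simp)+

lemma eppa_graph_extend:
  assumes "eppa_graph n V E \<iota>" "H \<subseteq> A" "inj_on f H" "f ` H \<subseteq> A"
    and "\<And>x y. x \<in> H \<Longrightarrow> y \<in> H \<Longrightarrow> d (f x) (f y) = d x y"
  obtains g where "graph_aut V E g" "\<And>x. x \<in> H \<Longrightarrow> g (\<iota> x) = \<iota> (f x)"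
proof -
  have "\<forall>x\<in>H. \<forall>y\<in>H. d (f x) (f y) = d x y" using assms(5) by blast
  moreover have "\<forall>H f. H \<subseteq> A \<longrightarrow> inj_on f H \<longrightarrow> f ` H \<subseteq> A \<longrightarrow>
      (\<forall>x\<in>H. \<forall>y\<in>H. d (f x) (f y) = d x y) \<longrightarrow>
      (\<exists>g. graph_aut V E g \<and> (\<forall>x\<in>H. g (\<iota> x) = \<iota> (f x)))"
    using assms(1) unfolding eppa_graph_def by (elim conjE)
  ultimately have "\<exists>g. graph_aut V E g \<and> (\<forall>x\<in>H. g (\<iota> x) = \<iota> (f x))"
    using assms(2-4) by (elim allE[where x = H] allE[where x = f] impE)
  then show thesis using that by blast
qed

text \<open>The cover changes the vertex type; renaming vertices returns to \<open>'a\<close>, with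
  \<open>A\<close> embedded identically, so that the induction can go on.\<close>

lemma eppa_graph_transport:
  fixes V :: "'v set" and \<iota> :: "'a \<Rightarrow> 'v"
  assumes W: "eppa_graph n V E \<iota>" and inf: "infinite (UNIV :: 'a set)"
  shows "\<exists>V' E'. eppa_graph n V' E' (\<lambda>x::'a. x)"
proof -
  note finV = eppa_graphD(1)[OF W] and \<iota> = eppa_graphD(2,3)[OF W] and E = eppa_graphD(4)[OF W]
    and EA = eppa_graphD(5)[OF W] and nb = eppa_graphD(6)[OF W]
  have "infinite (UNIV - A)" using inf finite_A by simp
  then obtain S where S: "finite S" "card S = card (V - \<iota> ` A)" "S \<subseteq> UNIV - A"
    by (meson infinite_arbitrarily_large)
  then obtain k where k: "bij_betw k (V - \<iota> ` A) S"
    using finV by (metis finite_Diff finite_same_card_bij)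
  \<comment> \<open>Undo \<open>\<iota>\<close> on the copy of \<open>A\<close>; the other vertices
    go to the fresh points \<open>S\<close>.\<close>
  define j where "j z = (if z \<in> \<iota> ` A then inv_into A \<iota> z else k z)" for z
  have j\<iota>: "j (\<iota> x) = x" if "x \<in> A" for x
    using that \<iota> by (simp add: j_def)
  have "bij_betw j (\<iota> ` A \<union> (V - \<iota> ` A)) (A \<union> S)"
  proof (rule bij_betw_combine)
    show "bij_betw j (\<iota> ` A) A"
      using bij_betw_inv_into[OF inj_on_imp_bij_betw[OF \<iota>(2)]]
      by (rule bij_betw_cong[THEN iffD1, rotated]) (auto simp: j_def)
    show "bij_betw j (V - \<iota> ` A) S"
      using k by (rule bij_betw_cong[THEN iffD1, rotated]) (auto simp: j_def)
  qed (use S in auto)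
  then have inj: "inj_on j V" using \<iota>(1) by (simp add: Un_absorb1 bij_betw_def)
  define i where "i = inv_into V j"
  have ij: "i (j x) = x" if "x \<in> V" for x
    using inj that by (simp add: i_def)
  define E' where "E' a b l \<longleftrightarrow> (\<exists>x\<in>V. \<exists>y\<in>V. a = j x \<and> b = j y \<and> E x y l)" for a b l
  have E'j: "E' (j x) (j y) l \<longleftrightarrow> E x y l" if "x \<in> V" "y \<in> V" for x y l
    using that inj by (auto simp: E'_def inj_on_def)
  have "eppa_graph n (j ` V) E' (\<lambda>x. x)"
    unfolding eppa_graph_def
  proof (intro conjI allI impI ballI)
    show "(\<lambda>x. x) ` A \<subseteq> j ` V" using \<iota>(1) j\<iota> by force
    show "x \<in> j ` V" "y \<in> j ` V" "x \<noteq> y" "l \<in> L" "E' y x l" if xyl: "E' x y l" for x y l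
    proof -
      obtain a b where ab: "x = j a" "y = j b" "a \<in> V" "b \<in> V" "E a b l"
        using xyl unfolding E'_def by blast
      then show "x \<in> j ` V" "y \<in> j ` V" "x \<noteq> y" "l \<in> L" "E' y x l"
        using E[OF ab(5)] inj_onD[OF inj] by (auto simp: E'j)
    qed
    show "E' x y (d x y)" if "x \<in> A" "y \<in> A" "x \<noteq> y" for x y
      using EA[OF that] E'j[of "\<iota> x" "\<iota> y"] \<iota>(1) that by (auto simp: j\<iota>)
    show "\<not> bad (map fst p)" if "walk E' x p x" "length p \<le> n" for x p
    proof -
      have "walk E (i x) (map (apsnd i) p) (i x)"
        using that(1) by (rule walk_map[rotated]) (auto simp: E'_def ij)
      then show ?thesis using nb[of "i x" "map (apsnd i) p"] that(2) by simp
    qed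
    show "\<exists>g. graph_aut (j ` V) E' g \<and> (\<forall>x\<in>H. g x = f x)"
      if H: "H \<subseteq> A" "inj_on f H" "f ` H \<subseteq> A" "\<forall>x\<in>H. \<forall>y\<in>H. d (f x) (f y) = d x y" for H f
    proof -
      obtain g where g: "graph_aut V E g" "\<And>x. x \<in> H \<Longrightarrow> g (\<iota> x) = \<iota> (f x)"
        using eppa_graph_extend[OF W H(1-3)] H(4) by blast
      have bij: "bij_betw g V V" and gE: "\<And>x y l. x \<in> V \<Longrightarrow> y \<in> V \<Longrightarrow> E (g x) (g y) l \<longleftrightarrow> E x y l"
        using g(1) unfolding graph_aut_def by auto
      have gV: "g x \<in> V" if "x \<in> V" for x using bij that by (auto simp: bij_betw_def)
      have jV: "bij_betw j V (j ` V)" using inj by (rule inj_on_imp_bij_betw)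
      have "bij_betw (j \<circ> (g \<circ> i)) (j ` V) (j ` V)"
        unfolding i_def by (intro bij_betw_trans[OF bij_betw_trans[OF bij_betw_inv_into[OF jV] bij] jV])
      then have "graph_aut (j ` V) E' (j \<circ> (g \<circ> i))"
        unfolding graph_aut_def using E'j gE gV ij by auto
      moreover have "(j \<circ> (g \<circ> i)) x = f x" if "x \<in> H" for x
      proof -
        have "x \<in> A" "f x \<in> A" "\<iota> x \<in> V" using H(1,3) \<iota>(1) that by auto
        then show ?thesis using ij[of "\<iota> x"] g(2)[OF that] j\<iota>[of x] j\<iota>[of "f x"] by simp
      qed
      ultimately show ?thesis by blast
    qed
  qed (use finV in auto)
  then show ?thesis by blast
qed

section \<open>The cover that kills the bad cycles of length \<open>n + 1\<close>\<close>

context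
  fixes n :: nat and V :: "'a set" and E :: "'a \<Rightarrow> 'a \<Rightarrow> 'l \<Rightarrow> bool"
  assumes W: "eppa_graph n V E (\<lambda>x. x)" and n: "1 \<le> n"
begin

definition cycles :: "('a \<times> ('l \<times> 'a) list) set" where
  "cycles = {(v, p). walk E v p v \<and> length p = Suc n \<and> bad (map fst p)}"

definition verts :: "'a \<times> ('l \<times> 'a) list \<Rightarrow> 'a set" where
  "verts U = snd ` set (snd U)"

text \<open>Since cycles are based and oriented, automorphisms map first edges to first edges.\<close>

definition first_edge :: "'a \<times> ('l \<times> 'a) list \<Rightarrow> 'a \<Rightarrow> 'a \<Rightarrow> 'l \<Rightarrow> bool" where
  "first_edge U x y l \<longleftrightarrow>
     x = fst U \<and> (l, y) = hd (snd U) \<or> y = fst U \<and> (l, x) = hd (snd U)"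

text \<open>A vector of bits is encoded as the set of cycles whose bit is 1.\<close>

definition cover_verts :: "('a \<times> ('a \<times> ('l \<times> 'a) list) set) set" where
  "cover_verts = {(x, S). x \<in> V \<and> S \<subseteq> {U \<in> cycles. x \<in> verts U}}"

text \<open>Along a lift of a cycle \<open>U\<close> the bit at \<open>U\<close> changes exactly once, on the first edge, so
  the lift cannot close up.\<close>

definition cover_edge where
  "cover_edge a b l \<longleftrightarrow> a \<in> cover_verts \<and> b \<in> cover_verts \<and> E (fst a) (fst b) l \<and>
     (\<forall>U\<in>cycles. fst a \<in> verts U \<longrightarrow> fst b \<in> verts U \<longrightarrow>
        ((U \<in> snd a) \<noteq> (U \<in> snd b)) = first_edge U (fst a) (fst b) l)"

text \<open>For \<open>x\<close> in \<open>A\<close>, the bit at \<open>U\<close> is set only if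
  \<open>x\<close> is the base point and the first edge of \<open>U\<close> is an edge of
  \<open>A\<close> with its label from \<open>d\<close>.\<close>

definition cover_emb :: "'a \<Rightarrow> 'a \<times> ('a \<times> ('l \<times> 'a) list) set" where
  "cover_emb x = (x, {U \<in> cycles. x = fst U \<and> snd (hd (snd U)) \<in> A \<and>
     d x (snd (hd (snd U))) = fst (hd (snd U))})"

lemma E_props: "E x y l \<Longrightarrow> x \<in> V \<and> y \<in> V \<and> x \<noteq> y \<and> l \<in> L \<and> E y x l"
  and A_subset: "A \<subseteq> V"
  and E_A: "x \<in> A \<Longrightarrow> y \<in> A \<Longrightarrow> x \<noteq> y \<Longrightarrow> E x y (d x y)"
  and no_short_bad: "walk E x p x \<Longrightarrow> length p \<le> n \<Longrightarrow> \<not> bad (map fst p)"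
  and fin_V: "finite V"
  using eppa_graphD[OF W] by auto

lemma cycle_cases:
  assumes "U \<in> cycles"
  obtains v l w q where "U = (v, (l, w) # q)" "E v w l" "walk E w q v" "length q = n"
    "bad (l # map fst q)" "q \<noteq> []" "verts U = insert w (snd ` set q)" "v \<in> snd ` set q"
proof -
  obtain v p where U: "U = (v, p)" "walk E v p v" "length p = Suc n" "bad (map fst p)"
    using assms unfolding cycles_def by auto
  then obtain l w q where p: "p = (l, w) # q" by (cases p) auto
  have "q \<noteq> []" using U(3) n p by auto
  then show thesis using that[of v l w q] U p walk_end_in[of E w q v] by (auto simp: verts_def)
qed

lemma cycle_verts: "U \<in> cycles \<Longrightarrow> verts U \<subseteq> V"
  unfolding cycles_def verts_def
  using walk_labels_vertices[of E V L] E_props by (auto, fastforce)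

lemma fst_in_verts: "U \<in> cycles \<Longrightarrow> fst U \<in> verts U"
  by (erule cycle_cases) auto

lemma finite_cycles: "finite cycles"
proof -
  have "cycles \<subseteq> V \<times> {p. set p \<subseteq> L \<times> V \<and> length p = Suc n}"
  proof
    fix U assume U: "U \<in> cycles"
    then have "fst U \<in> V"
      using cycle_verts fst_in_verts by blast
    moreover have "set (snd U) \<subseteq> L \<times> V"
      using U walk_labels_vertices[of E V L] E_props unfolding cycles_def by (auto, fastforce+)
    ultimately show "U \<in> V \<times> {p. set p \<subseteq> L \<times> V \<and> length p = Suc n}"
      using U by (auto simp: cycles_def)
  qed
  then show ?thesis
    by (rule finite_subset) (intro finite_cartesian_product fin_V finite_lists_length_eq finite_L)
qed

lemma finite_cover_verts: "finite cover_verts"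
proof -
  have "cover_verts \<subseteq> V \<times> Pow cycles" unfolding cover_verts_def by auto
  then show ?thesis by (rule finite_subset) (simp add: fin_V finite_cycles)
qed

lemma cover_verts_eqI:
  assumes "a \<in> cover_verts" "b \<in> cover_verts" "fst a = fst b"
    and "\<And>U. U \<in> cycles \<Longrightarrow> fst a \<in> verts U \<Longrightarrow> U \<in> snd a \<longleftrightarrow> U \<in> snd b"
  shows "a = b"
  using assms by (cases a; cases b; auto simp: cover_verts_def)

text \<open>The two remaining arcs of the cycle, each closed up by an edge of \<open>A\<close>, are shorter
  closed walks, and the third closing walk is a triangle of \<open>A\<close>; by the chord rule one of
  the three is bad.\<close>

lemma cycle_no_three_in_A:
  assumes "E v w l" "walk E w q v" "length q = n" "bad (l # map fst q)"
    and A: "v \<in> A" "w \<in> A" "y \<in> A" and dvw: "d v w = l" and y: "y \<in> snd ` set q" "y \<noteq> v" "y \<noteq> w"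
  shows False
proof -
  obtain q1 q2 where q: "q = q1 @ q2" "q1 \<noteq> []" "walk E w q1 y" "walk E y q2 v"
    using walk_split_at[OF assms(2) y(1)] by blast
  have "q2 \<noteq> []" using q(4) y(2) by auto
  have vw: "v \<noteq> w" using assms(1) E_props by blast
  have L: "d y w \<in> L" "d v y \<in> L" using d_in_L A y by auto
  have w1: "walk E w (q1 @ [(d y w, w)]) w" "walk E y (q2 @ [(d v y, y)]) y"
    using q E_A A y by (auto simp: walk_append)
  have len: "length (q1 @ [(d y w, w)]) \<le> n" "length (q2 @ [(d v y, y)]) \<le> n"
    using assms(3) q \<open>q2 \<noteq> []\<close> by (cases q1; cases q2; auto)+
  have nb: "\<not> bad (map fst q1 @ [d y w])" "\<not> bad (map fst q2 @ [d v y])"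
    using no_short_bad[OF w1(1) len(1)] no_short_bad[OF w1(2) len(2)] by auto
  have "bad (map fst q1 @ (map fst q2 @ [l]))"
    using bad_commute[of "[l]" "map fst q"] assms(4) q(1) by simp
  then have "bad ((map fst q2 @ [l]) @ [d y w])"
    using bad_chord[of "map fst q1" "map fst q2 @ [l]" "d y w"] L nb(1) by auto
  then have "bad ([l, d y w] @ [d v y])"
    using bad_chord[of "map fst q2" "[l, d y w]" "d v y"] L nb(2) by auto
  then have "bad [d v w, d w y, d y v]"
    by (simp add: dvw d_commute)
  then show False
    using not_bad_triangle[of v w y] A y vw by auto
qed

text \<open>Away from the base point \<open>v\<close> all bits are 0. If the first edge
  \<open>v w\<close> belongs to \<open>A\<close>, no third point of the cycle does, so a bit set at
  \<open>v\<close> is only compared with the one at \<open>w\<close>.\<close>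

lemma cover_emb_consistent:
  assumes A: "x \<in> A" "y \<in> A" "x \<noteq> y" and U: "U \<in> cycles" and xy: "x \<in> verts U" "y \<in> verts U"
  shows "((U \<in> snd (cover_emb x)) \<noteq> (U \<in> snd (cover_emb y))) = first_edge U x y (d x y)"
proof -
  obtain v l w q where u: "U = (v, (l, w) # q)" "E v w l" "walk E w q v" "length q = n"
    "bad (l # map fst q)" "verts U = insert w (snd ` set q)"
    using cycle_cases[OF U] by metis
  have *: "(U \<in> snd (cover_emb v)) = first_edge U v z (d v z)"
    if z: "z \<in> A" "z \<noteq> v" "z \<in> verts U" and v: "v \<in> A" for z
  proof (cases "z = w")
    case True
    then show ?thesis using U u(1) z by (auto simp: cover_emb_def first_edge_def)
  next
    case False
    then have "\<not> (w \<in> A \<and> d v w = l)"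
      using cycle_no_three_in_A[OF u(2-5) v _ z(1)] z u(6) by auto
    then show ?thesis using False z(2) by (auto simp: cover_emb_def first_edge_def u(1))
  qed
  have sym: "first_edge U x y (d x y) = first_edge U y x (d y x)"
    by (auto simp: first_edge_def d_commute)
  have n: "U \<notin> snd (cover_emb z)" if "z \<noteq> v" for z
    using that u(1) by (auto simp: cover_emb_def)
  consider "x = v" | "y = v" | "x \<noteq> v" "y \<noteq> v" by blast
  then show ?thesis
  proof cases
    case 1
    then show ?thesis using *[of y] n[of y] A xy by auto
  next
    case 2
    then show ?thesis using *[of x] n[of x] A xy sym by auto
  next
    case 3
    then show ?thesis using n by (auto simp: first_edge_def u(1))
  qed
qed

lemma cover_emb_in: "x \<in> A \<Longrightarrow> cover_emb x \<in> cover_verts"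
  using A_subset fst_in_verts by (auto simp: cover_emb_def cover_verts_def)

lemma cover_emb_edge:
  assumes "x \<in> A" "y \<in> A" "x \<noteq> y"
  shows "cover_edge (cover_emb x) (cover_emb y) (d x y)"
  unfolding cover_edge_def
proof (intro conjI ballI impI)
  show "((U \<in> snd (cover_emb x)) \<noteq> (U \<in> snd (cover_emb y))) =
      first_edge U (fst (cover_emb x)) (fst (cover_emb y)) (d x y)"
    if "U \<in> cycles" "fst (cover_emb x) \<in> verts U" "fst (cover_emb y) \<in> verts U" for U
    using cover_emb_consistent[OF assms that(1)] that(2,3) by (simp add: cover_emb_def)
qed (use assms cover_emb_in E_A in \<open>auto simp: cover_emb_def\<close>)

text \<open>A bad closed walk of length \<open>n + 1\<close> uses its first edge only once, since otherwise a shorter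
  bad closed walk could be split off.\<close>

lemma first_edge_once:
  assumes "E v w l" "walk E w q v" "length q = n" "bad (l # map fst q)"
    and q: "q = q1 @ (l', y) # q2" and x: "walk E w q1 x" "E x y l'" "walk E y q2 v"
  shows "\<not> first_edge (v, (l, w) # q) x y l'"
proof
  assume "first_edge (v, (l, w) # q) x y l'"
  then consider "x = v" | "y = v" "x = w" "l' = l" by (auto simp: first_edge_def)
  then show False
  proof cases
    case 1
    have "walk E v ((l, w) # q1) v" "walk E v ((l', y) # q2) v" using assms 1 by auto
    moreover have "length ((l, w) # q1) \<le> n" "length ((l', y) # q2) \<le> n"
      using assms(3) q by auto
    ultimately have "\<not> bad (l # map fst q1)" "\<not> bad (l' # map fst q2)"
      using no_short_bad[of v "(l, w) # q1"] no_short_bad[of v "(l', y) # q2"] by auto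
    then show False
      using bad_append[of "l # map fst q1" "l' # map fst q2"] assms(4) q by auto
  next
    case 2
    \<comment> \<open>The edge is passed in reverse: this leaves short closed walks
      \<open>q1\<close> at \<open>w\<close> and \<open>q2\<close> at \<open>v\<close>, and the
      harmless word \<open>[l, l]\<close>.\<close>
    have "walk E w q1 w" "walk E v q2 v" "length q1 \<le> n" "length q2 \<le> n"
      using x 2 assms(3) q by auto
    then have nb: "\<not> bad (map fst q1)" "\<not> bad (map fst q2)"
      using no_short_bad by blast+
    have "bad (map fst q1 @ (l # map fst q2 @ [l]))"
      using bad_commute[of "[l]" "map fst q"] assms(4) q 2 by simp
    then have "bad ((l # map fst q2) @ [l])" using bad_append nb by auto
    then have "bad ([l] @ (l # map fst q2))" by (rule bad_commute)
    then have "bad ([l, l] @ map fst q2)" by simp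
    then show False using bad_append nb not_bad_pair by blast
  qed
qed

lemma cover_edge_props:
  "cover_edge a b l \<Longrightarrow> a \<in> cover_verts \<and> b \<in> cover_verts \<and> a \<noteq> b \<and> l \<in> L \<and> cover_edge b a l"
  unfolding cover_edge_def using E_props[of "fst a" "fst b" l]
  by (auto simp: first_edge_def)

lemma cover_walk_project:
  "walk cover_edge a p b \<Longrightarrow> walk E (fst a) (map (apsnd fst) p) (fst b)"
  by (rule walk_map) (auto simp: cover_edge_def)

text \<open>No later edge of the lift is the first edge, so each step keeps the bit at
  \<open>U\<close>. In the induction \<open>q1\<close> is the part of \<open>q\<close> already
  traversed.\<close>

lemma cover_walk_valuation:
  assumes "E v w l" "walk E w q v" "length q = n" "bad (l # map fst q)"
    and "walk cover_edge a p b" "q = q1 @ map (apsnd fst) p" "walk E w q1 (fst a)"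
    and "fst a \<in> insert w (snd ` set q)" "fst b = v"
  defines "U \<equiv> (v, (l, w) # q)"
  shows "U \<in> snd a \<longleftrightarrow> U \<in> snd b"
  using assms(5-8)
proof (induction p arbitrary: a q1)
  case (Cons e p)
  obtain l' c where e: "e = (l', c)" by (cases e)
  have ac: "cover_edge a c l'" and cb: "walk cover_edge c p b" using Cons.prems(1) e by auto
  have q: "q = q1 @ (l', fst c) # map (apsnd fst) p" using Cons.prems(2) e by simp
  have E: "E (fst a) (fst c) l'" using ac by (simp add: cover_edge_def)
  have "walk E (fst c) (map (apsnd fst) p) v"
    using cover_walk_project[OF cb] assms(9) by simp
  then have "\<not> first_edge U (fst a) (fst c) l'"
    unfolding U_def using first_edge_once[OF assms(1-4) q Cons.prems(3) E] by blast
  moreover have "U \<in> cycles" using assms(1-4) by (simp add: U_def cycles_def)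
  moreover have "fst a \<in> verts U" "fst c \<in> verts U"
    using Cons.prems(4) q by (auto simp: U_def verts_def)
  ultimately have "U \<in> snd a \<longleftrightarrow> U \<in> snd c"
    using ac unfolding cover_edge_def by blast
  also have "\<dots> \<longleftrightarrow> U \<in> snd b"
    by (rule Cons.IH[OF cb, of "q1 @ [(l', fst c)]"]) (use q Cons.prems(3) E in \<open>auto simp: walk_append\<close>)
  finally show ?case .
qed simp

text \<open>Labels survive projection, so a bad walk would project to a member \<open>U\<close> of
  \<open>cycles\<close>. Its first step flips the bit at \<open>U\<close> and the others keep
  it.\<close>

lemma cover_no_bad:
  assumes p: "walk cover_edge a p a" "length p \<le> Suc n"
  shows "\<not> bad (map fst p)"
proof
  assume bad: "bad (map fst p)"
  let ?p = "map (apsnd fst) p"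
  have w: "walk E (fst a) ?p (fst a)" using cover_walk_project[OF p(1)] .
  then have len: "length p = Suc n"
    using no_short_bad[OF w] bad p(2) by (auto simp: le_Suc_eq)
  then obtain l b q where pq: "p = (l, b) # q" by (cases p) auto
  define U where "U = (fst a, ?p)"
  have U: "U \<in> cycles" using w len bad by (simp add: U_def cycles_def)
  have ab: "cover_edge a b l" and ba: "walk cover_edge b q a" using p(1) pq by auto
  have "E (fst a) (fst b) l" using ab by (simp add: cover_edge_def)
  moreover have wq: "walk E (fst b) (map (apsnd fst) q) (fst a)" using cover_walk_project[OF ba] .
  ultimately have "U \<in> snd b \<longleftrightarrow> U \<in> snd a"
    unfolding U_def using cover_walk_valuation[OF _ wq _ _ ba, of l "[]"] len bad by (simp add: pq)
  moreover have "first_edge U (fst a) (fst b) l" by (simp add: U_def first_edge_def pq)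
  moreover have "fst a \<in> verts U" using fst_in_verts[OF U] by (simp add: U_def)
  moreover have "fst b \<in> verts U" by (simp add: U_def verts_def pq)
  ultimately show False using ab U unfolding cover_edge_def by blast
qed

section \<open>Lifting automorphisms to the cover\<close>

definition act :: "('a \<Rightarrow> 'a) \<Rightarrow> 'a \<times> ('l \<times> 'a) list \<Rightarrow> 'a \<times> ('l \<times> 'a) list" where
  "act g U = (g (fst U), map (apsnd g) (snd U))"

text \<open>The bits at the cycles in \<open>F\<close> are flipped, which adjusts the lift of an automorphism to
  the chosen embedding of \<open>A\<close>.\<close>

definition lift where
  "lift g F a = (g (fst a), act g ` {U \<in> cycles. fst a \<in> verts U \<and> (U \<in> snd a) \<noteq> (U \<in> F)})"

context
  fixes g assumes g: "graph_aut V E g"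
begin

lemma g_bij: "bij_betw g V V" and g_E: "x \<in> V \<Longrightarrow> y \<in> V \<Longrightarrow> E (g x) (g y) l \<longleftrightarrow> E x y l"
  using g unfolding graph_aut_def by auto

lemma g_inj: "x \<in> V \<Longrightarrow> y \<in> V \<Longrightarrow> g x = g y \<longleftrightarrow> x = y"
  using g_bij by (auto simp: bij_betw_def inj_on_def)

lemma g_V: "x \<in> V \<Longrightarrow> g x \<in> V"
  using g_bij by (auto simp: bij_betw_def)

lemma act_cycles: "U \<in> cycles \<Longrightarrow> act g U \<in> cycles"
proof -
  have "E (g a) (g b) l" if "E a b l" for a b l using E_props[OF that] g_E that by blast
  then show "U \<in> cycles \<Longrightarrow> act g U \<in> cycles"
    using walk_map[of E E g] by (auto simp: cycles_def act_def)
qed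

lemma verts_act: "verts (act g U) = g ` verts U"
  by (force simp: verts_def act_def)

lemma g_verts: "U \<in> cycles \<Longrightarrow> x \<in> V \<Longrightarrow> g x \<in> verts (act g U) \<longleftrightarrow> x \<in> verts U"
  using cycle_verts[of U] g_inj by (auto simp: verts_act)

lemma act_inj: "inj_on (act g) cycles"
proof (rule inj_onI)
  fix U U' assume U: "U \<in> cycles" "U' \<in> cycles" and eq: "act g U = act g U'"
  have 1: "fst U = fst U'"
    using eq g_inj cycle_verts fst_in_verts U unfolding act_def by (metis fst_conv subsetD)
  have "inj_on (apsnd g) (UNIV \<times> V)"
    using g_inj by (auto simp: inj_on_def)
  moreover have "set (snd U) \<union> set (snd U') \<subseteq> UNIV \<times> V"
    using cycle_verts[OF U(1)] cycle_verts[OF U(2)] by (auto simp: verts_def)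
  ultimately have "inj_on (apsnd g) (set (snd U) \<union> set (snd U'))"
    by (rule inj_on_subset)
  then have "snd U = snd U'"
    using eq by (auto simp: act_def dest: map_inj_on)
  with 1 show "U = U'" by (rule prod_eqI)
qed

lemma act_surj: "act g ` cycles = cycles"
  using endo_inj_surj[OF finite_cycles _ act_inj] act_cycles by blast

lemma first_edge_act:
  assumes "U \<in> cycles" "x \<in> V" "y \<in> V"
  shows "first_edge (act g U) (g x) (g y) l \<longleftrightarrow> first_edge U x y l"
proof -
  obtain v l0 w q where u: "U = (v, (l0, w) # q)" "E v w l0" using cycle_cases[OF assms(1)] by metis
  have "v \<in> V" "w \<in> V" using E_props[OF u(2)] by auto
  then show ?thesis using assms g_inj by (auto simp: first_edge_def act_def u(1))
qed

lemma act_in_lift: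
  assumes "U \<in> cycles"
  shows "act g U \<in> snd (lift g F a) \<longleftrightarrow> fst a \<in> verts U \<and> (U \<in> snd a) \<noteq> (U \<in> F)"
  using assms act_inj by (auto simp: lift_def inj_on_def)

lemma lift_in: "a \<in> cover_verts \<Longrightarrow> lift g F a \<in> cover_verts"
  using act_cycles g_V by (auto simp: lift_def cover_verts_def verts_act)

lemma lift_inj: "inj_on (lift g F) cover_verts"
proof (rule inj_onI)
  fix a b assume ab: "a \<in> cover_verts" "b \<in> cover_verts" "lift g F a = lift g F b"
  then have f: "fst a = fst b" using g_inj by (auto simp: lift_def cover_verts_def)
  show "a = b"
  proof (rule cover_verts_eqI[OF ab(1,2) f])
    fix U assume "U \<in> cycles" "fst a \<in> verts U"
    then show "U \<in> snd a \<longleftrightarrow> U \<in> snd b"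
      using act_in_lift[of U F a] act_in_lift[of U F b] ab(3) f by auto
  qed
qed

text \<open>Only edges with both ends on \<open>U\<close> are tested at \<open>U\<close>, and there
  a flip changes both bits; moreover \<open>act g\<close> permutes the cycles and respects first
  edges.\<close>

lemma lift_aut: "graph_aut cover_verts cover_edge (lift g F)"
proof -
  have "lift g F ` cover_verts = cover_verts"
    using endo_inj_surj[OF finite_cover_verts _ lift_inj] lift_in by blast
  moreover have "cover_edge (lift g F a) (lift g F b) l \<longleftrightarrow> cover_edge a b l"
    if ab: "a \<in> cover_verts" "b \<in> cover_verts" for a b l
  proof -
    have V: "fst a \<in> V" "fst b \<in> V" using ab by (auto simp: cover_verts_def)
    have fl: "fst (lift g F c) = g (fst c)" for c by (simp add: lift_def)
    have "(\<forall>U\<in>cycles. g (fst a) \<in> verts U \<longrightarrow> g (fst b) \<in> verts U \<longrightarrow>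
        ((U \<in> snd (lift g F a)) \<noteq> (U \<in> snd (lift g F b))) = first_edge U (g (fst a)) (g (fst b)) l)
      \<longleftrightarrow> (\<forall>U\<in>act g ` cycles. g (fst a) \<in> verts U \<longrightarrow> g (fst b) \<in> verts U \<longrightarrow>
        ((U \<in> snd (lift g F a)) \<noteq> (U \<in> snd (lift g F b))) = first_edge U (g (fst a)) (g (fst b)) l)"
      by (simp only: act_surj)
    also have "\<dots> \<longleftrightarrow> (\<forall>U\<in>cycles. fst a \<in> verts U \<longrightarrow> fst b \<in> verts U \<longrightarrow>
        ((U \<in> snd a) \<noteq> (U \<in> snd b)) = first_edge U (fst a) (fst b) l)"
      unfolding ball_simps
      by (rule ball_cong[OF refl]) (auto simp: act_in_lift g_verts V first_edge_act)
    finally show ?thesis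
      using ab V by (simp add: cover_edge_def lift_in fl g_E)
  qed
  ultimately show ?thesis
    unfolding graph_aut_def bij_betw_def using lift_inj by blast
qed

end

text \<open>Some \<open>g\<close> extends \<open>f\<close> below, but its plain lift may miss the
  embedded points. \<open>flip x U\<close> records the error at \<open>U\<close>; it does not depend
  on the point \<open>x\<close> of \<open>H\<close> on \<open>U\<close>, so one set \<open>F\<close>
  corrects all errors.\<close>

lemma cover_extends:
  assumes H: "H \<subseteq> A" "inj_on f H" "f ` H \<subseteq> A" and d: "\<And>x y. x \<in> H \<Longrightarrow> y \<in> H \<Longrightarrow> d (f x) (f y) = d x y"
  shows "\<exists>h. graph_aut cover_verts cover_edge h \<and> (\<forall>x\<in>H. h (cover_emb x) = cover_emb (f x))"
proof -
  obtain g where g: "graph_aut V E g" "\<And>x. x \<in> H \<Longrightarrow> g x = f x"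
    using eppa_graph_extend[OF W H d] by blast
  define flip where
    "flip x U \<longleftrightarrow> (U \<in> snd (cover_emb x)) \<noteq> (act g U \<in> snd (cover_emb (f x)))" for x U
  define F where "F = {U \<in> cycles. \<exists>x\<in>H. x \<in> verts U \<and> flip x U}"
  \<comment> \<open>Between two points of \<open>A\<close> the embedding changes the bit exactly on
    a first edge, and \<open>g\<close> respects first edges.\<close>
  have same: "flip x U = flip y U"
    if U: "U \<in> cycles" and xy: "x \<in> H" "y \<in> H" "x \<in> verts U" "y \<in> verts U" for x y U
  proof (cases "x = y")
    case False
    have V: "x \<in> V" "y \<in> V" using xy H(1) A_subset by auto
    have "f x \<noteq> f y" "f x \<in> A" "f y \<in> A" using False H xy by (auto simp: inj_on_def)
    moreover have "f x \<in> verts (act g U)" "f y \<in> verts (act g U)"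
      using g_verts[OF g(1) U] V xy g(2) by metis+
    ultimately have "((act g U \<in> snd (cover_emb (f x))) \<noteq> (act g U \<in> snd (cover_emb (f y))))
        = first_edge (act g U) (f x) (f y) (d (f x) (f y))"
      by (intro cover_emb_consistent act_cycles[OF g(1) U])
    also have "\<dots> = first_edge U x y (d x y)"
      using first_edge_act[OF g(1) U V, of "d x y"] g(2) xy d by simp
    also have "\<dots> = ((U \<in> snd (cover_emb x)) \<noteq> (U \<in> snd (cover_emb y)))"
      using cover_emb_consistent[OF _ _ False U] xy H(1) by auto
    finally show ?thesis unfolding flip_def by auto
  qed simp
  have "lift g F (cover_emb x) = cover_emb (f x)" if x: "x \<in> H" for x
  proof (rule cover_verts_eqI)
    have xA: "x \<in> A" "f x \<in> A" using x H by auto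
    then have V: "x \<in> V" using A_subset by auto
    show "lift g F (cover_emb x) \<in> cover_verts" "cover_emb (f x) \<in> cover_verts"
      using lift_in[OF g(1)] cover_emb_in xA by auto
    show "fst (lift g F (cover_emb x)) = fst (cover_emb (f x))"
      using g(2) x by (simp add: lift_def cover_emb_def)
    fix U' assume U': "U' \<in> cycles" "fst (lift g F (cover_emb x)) \<in> verts U'"
    then obtain U where U: "U \<in> cycles" "U' = act g U" using act_surj[OF g(1)] by blast
    have xU: "x \<in> verts U"
      using U'(2) g_verts[OF g(1) U(1) V] U(2) by (simp add: lift_def cover_emb_def)
    have "U \<in> F \<longleftrightarrow> flip x U"
      unfolding F_def using U(1) x xU same[OF U(1)] by blast
    moreover have "fst (cover_emb x) = x" by (simp add: cover_emb_def)
    ultimately show "U' \<in> snd (lift g F (cover_emb x)) \<longleftrightarrow> U' \<in> snd (cover_emb (f x))"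
      using act_in_lift[OF g(1) U(1), of F "cover_emb x"] xU U(2) by (auto simp: flip_def)
  qed
  then show ?thesis using lift_aut[OF g(1), of F] by blast
qed

lemma eppa_graph_cover: "eppa_graph (Suc n) cover_verts cover_edge cover_emb"
  unfolding eppa_graph_def
proof (intro conjI allI impI ballI)
  show "inj_on cover_emb A" by (rule inj_onI) (simp add: cover_emb_def)
  show "\<exists>g. graph_aut cover_verts cover_edge g \<and> (\<forall>x\<in>H. g (cover_emb x) = cover_emb (f x))"
    if "H \<subseteq> A" "inj_on f H" "f ` H \<subseteq> A" "\<forall>x\<in>H. \<forall>y\<in>H. d (f x) (f y) = d x y" for H f
    using cover_extends[of H f] that by blast
  show "\<not> bad (map fst p)" if "walk cover_edge a p a" "length p \<le> Suc n" for a p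
    using cover_no_bad[OF that] .
qed (use cover_edge_props cover_emb_in cover_emb_edge finite_cover_verts in blast)+

end

theorem eppa_graph_exists:
  assumes "infinite (UNIV :: 'a set)"
  shows "\<exists>V E. eppa_graph (Suc n) V E (\<lambda>x::'a. x)"
proof (induction n)
  case 0
  show ?case using eppa_graph_base by (metis One_nat_def)
next
  case (Suc n)
  then obtain V E where "eppa_graph (Suc n) V E (\<lambda>x::'a. x)" by blast
  from eppa_graph_transport[OF eppa_graph_cover[OF this] assms] show ?case by simp
qed

end

subsection \<open>Completing a graph without bad closed walks\<close>

text \<open>\<open>marked_weight c w b s\<close>: \<open>s\<close> is the length of a walk in the double cover over a walk with
  labels \<open>w\<close>, where an edge labelled \<open>l\<close> contributes \<open>2 * l\<close> if it stays on a sheet and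
  \<open>c - 2 * l\<close> if it is marked, that is, if it changes the sheet; \<open>b\<close> is the parity of the
  number of marks. All distances in the double cover are doubled to keep them integral.\<close>

fun marked_weight :: "nat \<Rightarrow> nat list \<Rightarrow> bool \<Rightarrow> int \<Rightarrow> bool" where
  "marked_weight c [] b s \<longleftrightarrow> \<not> b \<and> s = 0"
| "marked_weight c (l # w) b s \<longleftrightarrow>
     marked_weight c w b (s - 2 * int l) \<or> marked_weight c w (\<not> b) (s - (int c - 2 * int l))"

text \<open>Parities of marks add up: \<open>a \<noteq> b\<close> is exclusive or.\<close>

lemma marked_weight_append:
  "marked_weight c (u @ w) b s \<longleftrightarrow>
     (\<exists>a t. marked_weight c u a t \<and> marked_weight c w (a \<noteq> b) (s - t))"
proof (induction u arbitrary: b s)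
  case Nil
  show ?case by (simp add: ex_bool_eq)
next
  case (Cons l u)
  show ?case (is "?L \<longleftrightarrow> ?R")
  proof
    assume ?L
    then consider a t where "marked_weight c u a t" "marked_weight c w (a \<noteq> b) (s - 2 * int l - t)"
      | a t where "marked_weight c u a t" "marked_weight c w (a \<noteq> (\<not> b)) (s - (int c - 2 * int l) - t)"
      using Cons.IH by auto
    then show ?R
    proof cases
      case 1
      then show ?thesis
        by (intro exI[of _ a] exI[of _ "t + 2 * int l"]) (auto simp: algebra_simps)
    next
      case 2
      then show ?thesis
        by (intro exI[of _ "\<not> a"] exI[of _ "t + (int c - 2 * int l)"]) (cases a; auto simp: algebra_simps)
    qed
  next
    assume ?R
    then obtain a t where w: "marked_weight c w (a \<noteq> b) (s - t)"
      and "marked_weight c u a (t - 2 * int l) \<or> marked_weight c u (\<not> a) (t - (int c - 2 * int l))"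
      by auto
    then consider "marked_weight c u a (t - 2 * int l)" | "marked_weight c u (\<not> a) (t - (int c - 2 * int l))"
      by blast
    then show ?L
    proof cases
      case 1
      then have "marked_weight c (u @ w) b (s - 2 * int l)"
        unfolding Cons.IH using w
        by (intro exI[of _ a] exI[of _ "t - 2 * int l"]) (auto simp: algebra_simps)
      then show ?thesis by simp
    next
      case 2
      then have "marked_weight c (u @ w) (\<not> b) (s - (int c - 2 * int l))"
        unfolding Cons.IH using w
        by (intro exI[of _ "\<not> a"] exI[of _ "t - (int c - 2 * int l)"]) (cases a; auto simp: algebra_simps)
      then show ?thesis by simp
    qed
  qed
qed

lemma marked_weight_appendI:
  assumes "marked_weight c u a s" "marked_weight c w b t"
  shows "marked_weight c (u @ w) (a \<noteq> b) (s + t)"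
  unfolding marked_weight_append using assms
  by (intro exI[of _ a] exI[of _ s]) (cases a; cases b; auto)

lemma marked_weight_commute:
  assumes "marked_weight c (u @ w) b s"
  shows "marked_weight c (w @ u) b s"
proof -
  obtain a t where "marked_weight c u a t" "marked_weight c w (a \<noteq> b) (s - t)"
    using assms by (auto simp: marked_weight_append)
  then show ?thesis
    using marked_weight_appendI[of c w "a \<noteq> b" "s - t" u a t] by (cases a; cases b; auto)
qed

lemma marked_weight_snoc:
  "marked_weight c (w @ [l]) b s \<longleftrightarrow> marked_weight c (l # w) b s"
  using marked_weight_commute[of c w "[l]" b s] marked_weight_commute[of c "[l]" w b s] by auto

lemma marked_weight_rev: "marked_weight c (rev w) b s \<longleftrightarrow> marked_weight c w b s"
  by (induction w arbitrary: b s) (auto simp: marked_weight_snoc)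

lemma marked_weight_unmarked: "marked_weight c w False (2 * int (sum_list w))"
  by (induction w) auto

lemma marked_weight_parity: "marked_weight c w b s \<Longrightarrow> even (s - (if b then int c else 0))"
proof (induction w arbitrary: b s)
  case (Cons l w)
  then show ?case by (cases b) (auto dest!: Cons.IH)
qed auto

section \<open>Bad words for the given parameters\<close>

locale metric_params =
  fixes \<delta> K c :: nat
  assumes K_pos: "1 \<le> K" and K_le: "K \<le> \<delta>" and c_lower: "2 * \<delta> + K \<le> c" and c_upper: "c \<le> 3 * \<delta>"
begin

definition bad_word :: "nat list \<Rightarrow> bool" where
  "bad_word w \<longleftrightarrow> set w \<subseteq> {1..\<delta>} \<and>
     ((\<exists>s < int c. marked_weight c w True s) \<or> odd (sum_list w) \<and> sum_list w < 2 * K + 1)"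

text \<open>An unmarked edge weighs at least 2, a marked one at least
  \<open>c - 2 * \<delta> \<ge> K\<close>. So an even number of marks and weight below
  \<open>2 * K\<close> leave no marks at all.\<close>

lemma marked_weight_bounds:
  assumes "set w \<subseteq> {1..\<delta>}" "marked_weight c w b s"
  shows "int (length w) \<le> s \<and> (b \<longrightarrow> int K \<le> s) \<and>
    (\<not> b \<and> s < 2 * int K \<longrightarrow> s = 2 * int (sum_list w))"
  using assms
proof (induction w arbitrary: b s)
  case (Cons l w)
  then have w: "set w \<subseteq> {1..\<delta>}" and l: "1 \<le> l" "l \<le> \<delta>" by auto
  show ?case
    using Cons.IH[OF w, of b "s - 2 * int l"] Cons.IH[OF w, of "\<not> b" "s - (int c - 2 * int l)"]
      Cons.prems(2) l c_lower K_pos by (cases b) auto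
qed auto

text \<open>Each letter adds at least 1 to weight and label sum; the weight is below
  \<open>c\<close>, or the sum is at most \<open>2 * K \<le> c\<close>.\<close>

lemma bad_word_length:
  assumes "bad_word w"
  shows "length w \<le> c"
proof -
  have w: "set w \<subseteq> {1..\<delta>}" using assms by (simp add: bad_word_def)
  consider s where "s < int c" "marked_weight c w True s" | "sum_list w < 2 * K + 1"
    using assms by (auto simp: bad_word_def)
  then show ?thesis
  proof cases
    case 1
    then show ?thesis using marked_weight_bounds[OF w 1(2)] by simp
  next
    case 2
    have "length w \<le> sum_list w" using w by (induction w) auto
    then show ?thesis using 2 c_lower K_le by simp
  qed
qed

lemma bad_word_append:
  assumes "bad_word (u @ w)"
  shows "bad_word u \<or> bad_word w"
proof -
  have uw: "set u \<subseteq> {1..\<delta>}" "set w \<subseteq> {1..\<delta>}" using assms by (auto simp: bad_word_def)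
  consider s where "s < int c" "marked_weight c (u @ w) True s"
    | "odd (sum_list (u @ w))" "sum_list (u @ w) < 2 * K + 1"
    using assms by (auto simp: bad_word_def)
  then show ?thesis
  proof cases
    case 1
    then obtain a t where at: "marked_weight c u a t" "marked_weight c w (\<not> a) (s - t)"
      by (auto simp: marked_weight_append)
    have "0 \<le> t" "0 \<le> s - t"
      using marked_weight_bounds[OF uw(1) at(1)] marked_weight_bounds[OF uw(2) at(2)] by auto
    then have "t < int c" "s - t < int c" using 1(1) by auto
    then show ?thesis using at uw by (cases a) (auto simp: bad_word_def)
  next
    case 2
    then show ?thesis using uw by (cases "odd (sum_list u)") (auto simp: bad_word_def)
  qed
qed

lemma bad_word_chord:
  assumes "bad_word (u @ w)" and l: "l \<in> {1..\<delta>}"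
  shows "bad_word (u @ [l]) \<or> bad_word (w @ [l])"
proof -
  have uw: "set (u @ [l]) \<subseteq> {1..\<delta>}" "set (w @ [l]) \<subseteq> {1..\<delta>}"
    using assms by (auto simp: bad_word_def)
  \<comment> \<open>\<open>x\<close> is the part with oddly many marks. If the unmarked chord makes
    it too heavy, then \<open>t < 2 * l\<close>, and \<open>y\<close> is bad with the chord
    marked.\<close>
  have marks: "bad_word (x @ [l]) \<or> bad_word (y @ [l])"
    if x: "set (x @ [l]) \<subseteq> {1..\<delta>}" "set (y @ [l]) \<subseteq> {1..\<delta>}"
      and s: "marked_weight c x True s" "marked_weight c y False t" "s + t < int c" for x y s t
  proof (cases "s + 2 * int l < int c")
    case True
    then have "bad_word (x @ [l])"
      using s x unfolding bad_word_def marked_weight_snoc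
      by (intro conjI disjI1 exI[of _ "s + 2 * int l"]) auto
    then show ?thesis ..
  next
    case False
    then have "bad_word (y @ [l])"
      using s x unfolding bad_word_def marked_weight_snoc
      by (intro conjI disjI1 exI[of _ "t + (int c - 2 * int l)"]) auto
    then show ?thesis ..
  qed
  \<comment> \<open>\<open>x\<close> is the part that the chord makes odd; as the total is odd,
    exactly one part is. If it becomes too long, \<open>l\<close> exceeds the sum of
    \<open>y\<close>, and marking \<open>l\<close> alone makes \<open>y\<close> bad.\<close>
  have parity: "bad_word (x @ [l]) \<or> bad_word (y @ [l])"
    if x: "set (x @ [l]) \<subseteq> {1..\<delta>}" "set (y @ [l]) \<subseteq> {1..\<delta>}"
      and s: "odd (sum_list x + l)" "sum_list x + sum_list y < 2 * K + 1" for x y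
  proof (cases "sum_list x + l < 2 * K + 1")
    case True
    then have "bad_word (x @ [l])" using x s by (auto simp: bad_word_def)
    then show ?thesis ..
  next
    case False
    then have "bad_word (y @ [l])"
      using s x marked_weight_unmarked[of c y] unfolding bad_word_def marked_weight_snoc
      by (intro conjI disjI1 exI[of _ "2 * int (sum_list y) + (int c - 2 * int l)"]) auto
    then show ?thesis ..
  qed
  consider s where "s < int c" "marked_weight c (u @ w) True s"
    | "odd (sum_list (u @ w))" "sum_list (u @ w) < 2 * K + 1"
    using assms by (auto simp: bad_word_def)
  then show ?thesis
  proof cases
    case 1
    then obtain a t where at: "marked_weight c u a t" "marked_weight c w (\<not> a) (s - t)"
      by (auto simp: marked_weight_append)
    then show ?thesis
      using marks[OF uw, of t "s - t"] marks[OF uw(2,1), of "s - t" t] 1(1) by (cases a) auto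
  next
    case 2
    then show ?thesis
      using parity[OF uw] parity[OF uw(2,1)] by (cases "odd (sum_list u + l)") auto
  qed
qed

lemma bad_word_commute: "bad_word (u @ w) \<Longrightarrow> bad_word (w @ u)"
  unfolding bad_word_def using marked_weight_commute[of c u w]
  by (auto simp: add.commute)

text \<open>One mark of weight below \<open>c\<close> is a violated triangle inequality; three marks
  mean a perimeter above \<open>c\<close>.\<close>

lemma bad_word_triangle:
  assumes "bad_word [x, y, z]"
  shows "y + z < x \<or> x + z < y \<or> x + y < z \<or> c < x + y + z \<or> odd (x + y + z) \<and> x + y + z < 2 * K + 1"
  using assms by (auto simp: bad_word_def)

end

section \<open>Distances in the double cover\<close>

locale good_graph = metric_params +
  fixes V :: "'v set" and E :: "'v \<Rightarrow> 'v \<Rightarrow> nat \<Rightarrow> bool"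
  assumes E_props: "E x y l \<Longrightarrow> x \<in> V \<and> y \<in> V \<and> x \<noteq> y \<and> l \<in> {1..\<delta>} \<and> E y x l"
    and no_bad_walk: "walk E x p x \<Longrightarrow> \<not> bad_word (map fst p)"
begin

text \<open>Distance in the double cover, capped at \<open>2 * c\<close> because the graph may be disconnected.\<close>

definition rho :: "bool \<Rightarrow> 'v \<Rightarrow> 'v \<Rightarrow> int" where
  "rho b u v = Min (insert (2 * int c)
     {s \<in> {0..2 * int c}. \<exists>p. walk E u p v \<and> marked_weight c (map fst p) b s})"

lemma finite_rho_weights:
  "finite {s \<in> {0..2 * int c}. \<exists>p. walk E u p v \<and> marked_weight c (map fst p) b s}"
  by (rule finite_subset[of _ "{0..2 * int c}"]) auto

lemma walk_labels: "walk E u p v \<Longrightarrow> set (map fst p) \<subseteq> {1..\<delta>}"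
  using walk_labels_vertices[of E V "{1..\<delta>}" u p v] E_props by fastforce

lemma rho_cases:
  obtains "rho b u v = 2 * int c" | p where "walk E u p v" "marked_weight c (map fst p) b (rho b u v)"
proof -
  have "rho b u v \<in> insert (2 * int c)
     {s \<in> {0..2 * int c}. \<exists>p. walk E u p v \<and> marked_weight c (map fst p) b s}"
    unfolding rho_def by (rule Min_in) (simp_all only: finite_insert finite_rho_weights, simp)
  then show thesis using that by auto
qed

lemma rho_le_cap: "rho b u v \<le> 2 * int c"
  unfolding rho_def by (rule Min_le) (simp_all only: finite_insert finite_rho_weights, simp)

lemma rho_le:
  assumes "walk E u p v" "marked_weight c (map fst p) b s"
  shows "rho b u v \<le> s"
proof (cases "s \<le> 2 * int c")
  case True
  have "0 \<le> s" using marked_weight_bounds[OF walk_labels[OF assms(1)] assms(2)] by linarith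
  then show ?thesis unfolding rho_def using assms True
    by (intro Min_le) (simp_all only: finite_insert finite_rho_weights, auto)
next
  case False
  then show ?thesis using rho_le_cap[of b u v] by linarith
qed

lemma rho_nonneg: "0 \<le> rho b u v"
proof (cases rule: rho_cases[of b u v])
  case (2 p)
  then show ?thesis using marked_weight_bounds[OF walk_labels[OF 2(1)] 2(2)] by linarith
qed auto

lemma rho_triangle: "rho (a \<noteq> b) u w \<le> rho a u v + rho b v w"
proof (cases rule: rho_cases[of a u v])
  case 1
  then show ?thesis using rho_nonneg[of b v w] rho_le_cap[of "a \<noteq> b" u w] by linarith
next
  case p: (2 p)
  show ?thesis
  proof (cases rule: rho_cases[of b v w])
    case 1
    then show ?thesis using rho_nonneg[of a u v] rho_le_cap[of "a \<noteq> b" u w] by linarith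
  next
    case q: (2 q)
    have "walk E u (p @ q) w" using p q by (auto simp: walk_append)
    moreover have "marked_weight c (map fst (p @ q)) (a \<noteq> b) (rho a u v + rho b v w)"
      using marked_weight_appendI[OF p(2) q(2)] by simp
    ultimately show ?thesis by (rule rho_le)
  qed
qed

lemma rho_sym_le: "rho b v u \<le> rho b u v"
proof (cases rule: rho_cases[of b u v])
  case 1
  then show ?thesis using rho_le_cap by simp
next
  case (2 p)
  obtain q where q: "walk E v q u" "map fst q = rev (map fst p)"
    using walk_reverse[OF _ 2(1)] E_props by blast
  then show ?thesis using rho_le[OF q(1)] 2(2) marked_weight_rev by metis
qed

lemma rho_sym: "rho b v u = rho b u v"
  by (intro antisym rho_sym_le)

text \<open>The absence of bad walks keeps the two points of a fibre at least \<open>c/2\<close>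
  apart.\<close>

lemma rho_True_self: "int c \<le> rho True u u"
proof (cases rule: rho_cases[of True u u])
  case (2 p)
  then show ?thesis
    using no_bad_walk[OF 2(1)] walk_labels[OF 2(1)] unfolding bad_word_def by force
qed simp

lemma rho_False_self: "rho False u u = 0"
  using rho_le[of u "[]" u False 0] rho_nonneg[of False u u] by simp

text \<open>The edge itself gives both upper bounds; they add up to \<open>c\<close>, which also
  bounds the sum from below.\<close>

lemma rho_edge:
  assumes "E u v l"
  shows "rho False u v = 2 * int l" "rho True u v = int c - 2 * int l"
proof -
  have "rho False u v \<le> 2 * int l" "rho True u v \<le> int c - 2 * int l"
    using assms by (auto intro!: rho_le[of u "[(l, v)]"])
  moreover have "int c \<le> rho False u v + rho True u v"
    using rho_triangle[of False True u u v] rho_True_self[of u] by (simp add: rho_sym[of True u v])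
  ultimately show "rho False u v = 2 * int l" "rho True u v = int c - 2 * int l" by linarith+
qed

lemma rho_sum: "int c \<le> rho False u v + rho True u v"
  using rho_triangle[of False True u u v] rho_True_self[of u] by (simp add: rho_sym[of True u v])

lemma rho_False_even: "even (rho False u v)"
  by (cases rule: rho_cases[of False u v]) (auto dest: marked_weight_parity)

lemma rho_True_parity: "rho True u v < 2 * int c \<Longrightarrow> even (rho True u v - int c)"
  by (cases rule: rho_cases[of True u v]) (auto dest: marked_weight_parity)

text \<open>An odd number of marks includes at least one, weighing at least
  \<open>c - 2 * \<delta>\<close>. This will keep \<open>dist_of\<close> at most
  \<open>\<delta>\<close>.\<close>

lemma rho_True_lower: "int c - 2 * int \<delta> \<le> rho True u v"
proof (cases rule: rho_cases[of True u v])
  case (2 p)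
  have *: "marked_weight c w True s \<Longrightarrow> set w \<subseteq> {1..\<delta>} \<Longrightarrow> int c - 2 * int \<delta> \<le> s" for w s
  proof (induction w arbitrary: s)
    case (Cons l w)
    then have w: "set w \<subseteq> {1..\<delta>}" "l \<le> \<delta>" by auto
    from Cons.prems(1) consider "marked_weight c w True (s - 2 * int l)"
      | "marked_weight c w False (s - (int c - 2 * int l))" by auto
    then show ?case
    proof cases
      case 1
      then show ?thesis using Cons.IH[OF 1 w(1)] by simp
    next
      case 2
      then show ?thesis using marked_weight_bounds[OF w(1) 2] w(2) by simp
    qed
  qed auto
  show ?thesis using *[OF 2(2) walk_labels[OF 2(1)]] .
qed simp

lemma rho_False_pos:
  assumes "u \<noteq> v"
  shows "0 < rho False u v"
proof (cases rule: rho_cases[of False u v])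
  case 1
  then show ?thesis using c_lower K_pos by simp
next
  case (2 p)
  then have "p \<noteq> []" using assms by auto
  then show ?thesis using marked_weight_bounds[OF walk_labels[OF 2(1)] 2(2)] by (cases p) auto
qed

lemma rho_small_walk:
  assumes "rho False u v < 2 * int K"
  obtains p where "walk E u p v" "rho False u v = 2 * int (sum_list (map fst p))"
proof (cases rule: rho_cases[of False u v])
  case 1
  then show ?thesis using assms c_lower K_le by simp
next
  case (2 p)
  then show ?thesis
    using that marked_weight_bounds[OF walk_labels[OF 2(1)] 2(2)] assms by auto
qed

section \<open>The completed distance\<close>

definition M :: int where
  "M = (int c - int \<delta>) div 2"

text \<open>Two sides \<open>M\<close> and a third side up to \<open>\<delta>\<close> then satisfy
  the triangle inequality and have perimeter at most \<open>c\<close>; \<open>K \<le> M\<close>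
  makes distances below \<open>K\<close> come from walks.\<close>

lemma M_bounds: "int \<delta> \<le> 2 * M" "int K \<le> M" "M \<le> int \<delta>" "2 * M \<le> int c - int \<delta>"
  using K_pos K_le c_lower c_upper unfolding M_def by auto

text \<open>\<open>rho False\<close> bounds (twice) the distance from above and \<open>c - rho True\<close> bounds it from
  below; among the admissible values the one closest to \<open>M\<close> is chosen.\<close>

definition dist_of :: "'v \<Rightarrow> 'v \<Rightarrow> int" where
  "dist_of u v = max (int c - rho True u v) (min (rho False u v) (2 * M)) div 2"

text \<open>The halving is exact: both bounds are even unless \<open>rho True\<close> is at the cap,
  and then the lower bound is negative and not the maximum.\<close>

lemma two_dist_of: "2 * dist_of u v = max (int c - rho True u v) (min (rho False u v) (2 * M))"
proof -
  have "even (max (int c - rho True u v) (min (rho False u v) (2 * M)))"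
  proof (cases "rho True u v < 2 * int c")
    case True
    then have "even (int c - rho True u v)" using rho_True_parity[of u v] by simp
    then show ?thesis using rho_False_even[of u v] by (auto simp: max_def min_def)
  next
    case False
    then show ?thesis using rho_False_even[of u v] rho_nonneg[of False u v] M_bounds
      by (auto simp: max_def min_def)
  qed
  then show ?thesis unfolding dist_of_def by simp
qed

lemma dist_of_sym: "dist_of u v = dist_of v u"
  unfolding dist_of_def by (simp add: rho_sym)

lemma dist_of_nonneg: "0 \<le> dist_of u v"
  using two_dist_of[of u v] rho_nonneg[of False u v] M_bounds by linarith

lemma dist_of_le: "dist_of u v \<le> int \<delta>"
  using two_dist_of[of u v] rho_True_lower[of u v] M_bounds by linarith

lemma dist_of_zero: "dist_of u v = 0 \<longleftrightarrow> u = v"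
proof
  assume "dist_of u v = 0"
  then show "u = v"
    using two_dist_of[of u v] rho_False_pos[of u v] M_bounds K_pos by fastforce
next
  assume "u = v"
  then show "dist_of u v = 0"
    using two_dist_of[of u v] rho_False_self[of u] rho_True_self[of u] M_bounds K_pos by simp
qed

lemma dist_of_edge: "E u v l \<Longrightarrow> dist_of u v = int l"
  using two_dist_of[of u v] rho_edge[of u v l] by simp

text \<open>A side below \<open>M\<close> is half of \<open>rho False\<close>. Both sides on the
  right below \<open>M\<close>: use \<open>rho False\<close>. Both at least \<open>M\<close>: use
  \<open>\<delta> \<le> 2 * M\<close>. Otherwise a left side above \<open>M\<close> equals its lower
  bound, which the short side carries over to the long one.\<close>

lemma dist_of_triangle: "dist_of u w \<le> dist_of u v + dist_of v w"
  using two_dist_of[of u w] two_dist_of[of u v] two_dist_of[of v w] M_bounds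
    rho_sum[of u w] rho_sum[of u v] rho_sum[of v w] dist_of_le[of u w]
    dist_of_nonneg[of u v] dist_of_nonneg[of v w]
    rho_triangle[of False False u w v] rho_triangle[of False True v w u]
    rho_triangle[of True False u v w]
  by (simp add: rho_sym[of False v u] rho_sym[of True v u] rho_sym[of True w v] rho_sym[of False w v])

text \<open>If at most one side exceeds \<open>M\<close>, use
  \<open>2 * M + \<delta> \<le> c\<close>. Two sides above \<open>M\<close> equal their lower
  bounds, and two sheet changes compose to a bound on \<open>rho False\<close> of the third.\<close>

lemma dist_of_perimeter: "dist_of u v + dist_of v w + dist_of w u \<le> int c"
  using two_dist_of[of w u] two_dist_of[of u v] two_dist_of[of v w] M_bounds
    rho_sum[of w u] rho_sum[of u v] rho_sum[of v w] dist_of_le[of w u] dist_of_le[of u v] dist_of_le[of v w]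
    rho_triangle[of True True u w v] rho_triangle[of True True v u w] rho_triangle[of True True w v u]
  by (simp add: rho_sym[of False u w] rho_sym[of False v u] rho_sym[of False w v])

lemma dist_of_odd_perimeter:
  assumes "odd (dist_of u v + dist_of v w + dist_of w u)"
  shows "2 * int K + 1 \<le> dist_of u v + dist_of v w + dist_of w u"
proof (rule ccontr)
  assume "\<not> ?thesis"
  then have less: "dist_of u v + dist_of v w + dist_of w u < 2 * int K + 1" by simp
  moreover have "dist_of u v + dist_of v w + dist_of w u \<noteq> 2 * int K"
    using assms by (metis dvd_triv_left)
  ultimately have less': "dist_of u v + dist_of v w + dist_of w u < 2 * int K" by linarith
  \<comment> \<open>No side exceeds half the perimeter.\<close>
  have "dist_of u v < int K" "dist_of v w < int K" "dist_of w u < int K"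
    using less' dist_of_triangle[of u v w] dist_of_triangle[of v w u] dist_of_triangle[of w u v]
    by (simp_all add: dist_of_sym)
  moreover have walk: "\<exists>p. walk E x p y \<and> dist_of x y = int (sum_list (map fst p))"
    if "dist_of x y < int K" for x y
  proof -
    \<comment> \<open>Below \<open>K \<le> M\<close> only \<open>rho False\<close> can determine the
      distance; being under \<open>2 * K\<close>, it comes from an unmarked walk.\<close>
    have r: "rho False x y < 2 * int K" "2 * dist_of x y = rho False x y"
      using that two_dist_of[of x y] M_bounds rho_sum[of x y] by linarith+
    obtain p where "walk E x p y" "rho False x y = 2 * int (sum_list (map fst p))"
      using rho_small_walk[OF r(1)] .
    then show ?thesis using r(2) by auto
  qed
  ultimately obtain p q r where pqr: "walk E u p v" "dist_of u v = int (sum_list (map fst p))"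
      "walk E v q w" "dist_of v w = int (sum_list (map fst q))"
      "walk E w r u" "dist_of w u = int (sum_list (map fst r))"
    by metis
  have W: "walk E u (p @ q @ r) u" using pqr by (auto simp: walk_append)
  have S: "dist_of u v + dist_of v w + dist_of w u = int (sum_list (map fst (p @ q @ r)))"
    using pqr by simp
  have "odd (sum_list (map fst (p @ q @ r)))" "sum_list (map fst (p @ q @ r)) < 2 * K + 1"
    using assms less unfolding S even_of_nat by linarith+
  then show False
    using no_bad_walk[OF W] walk_labels[OF W] unfolding bad_word_def by blast
qed

lemma rho_aut_le:
  assumes "graph_aut V E g"
  shows "rho b (g u) (g v) \<le> rho b u v"
proof (cases rule: rho_cases[of b u v])
  case 1
  then show ?thesis using rho_le_cap by simp
next
  case (2 p)
  have "walk E (g u) (map (apsnd g) p) (g v)"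
    using 2(1) by (rule walk_map[rotated]) (use assms E_props in \<open>auto simp: graph_aut_def\<close>)
  from rho_le[OF this, of b "rho b u v"] show ?thesis using 2(2) by simp
qed

text \<open>Neither \<open>g\<close> nor its inverse can increase \<open>rho\<close>.\<close>

lemma dist_of_aut:
  assumes g: "graph_aut V E g" and uv: "u \<in> V" "v \<in> V"
  shows "dist_of (g u) (g v) = dist_of u v"
proof -
  have "inv_into V g (g x) = x" if "x \<in> V" for x
    using g that by (auto simp: graph_aut_def bij_betw_def)
  then have "rho b (g u) (g v) = rho b u v" for b
    using rho_aut_le[OF g, of b u v] rho_aut_le[OF graph_aut_inv[OF g], of b "g u" "g v"] uv by simp
  then show ?thesis by (simp add: dist_of_def)
qed

lemma Metric_space_dist_of: "Metric_space V (\<lambda>u v. real_of_int (dist_of u v))"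
proof
  show "real_of_int (dist_of u w) \<le> real_of_int (dist_of u v) + real_of_int (dist_of v w)" for u v w
    using dist_of_triangle[of u w v] by linarith
qed (auto simp: dist_of_nonneg dist_of_sym dist_of_zero)

definition completion :: "'v metric" where
  "completion = metric (V, \<lambda>u v. real_of_int (dist_of u v))"

lemma mspace_completion: "mspace completion = V"
  and mdist_completion: "mdist completion u v = real_of_int (dist_of u v)"
  unfolding completion_def
  using Metric_space.mspace_metric[OF Metric_space_dist_of] Metric_space.mdist_metric[OF Metric_space_dist_of]
  by auto

lemma completion_in_class:
  assumes "finite V"
  shows "completion \<in> metric_class \<delta> K (Suc c)"
proof -
  have "perimeter completion u v w = real_of_int (dist_of u v + dist_of v w + dist_of w u)" for u v w
    by (simp add: perimeter_def mdist_completion)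
  moreover have "real_of_int (dist_of u v + dist_of v w + dist_of w u) < real (Suc c)" for u v w
    using dist_of_perimeter[of u v w] by linarith
  moreover have "real_of_int (dist_of u v) \<le> real \<delta>" for u v
    using dist_of_le[of u v] by linarith
  ultimately show ?thesis
    unfolding metric_class_def
    using assms dist_of_odd_perimeter by (auto simp del: of_int_add simp: mspace_completion mdist_completion)
qed

lemma completion_aut: "graph_aut V E g \<Longrightarrow> metric_automorphism completion g"
  unfolding metric_automorphism_def metric_isometry_def mspace_completion mdist_completion
  using dist_of_aut by (auto simp: graph_aut_def)

end

subsection \<open>The extension property\<close>

lemma metric_class_bad_words:
  fixes \<A> :: "'a metric"
  assumes params: "metric_params \<delta> K c" and \<A>: "\<A> \<in> metric_class \<delta> K (Suc c)"
  defines "d \<equiv> \<lambda>x y. nat \<lfloor>mdist \<A> x y\<rfloor>"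
  shows "bad_words (metric_params.bad_word \<delta> K c) {1..\<delta>} (mspace \<A>) d"
    and "\<And>x y. x \<in> mspace \<A> \<Longrightarrow> y \<in> mspace \<A> \<Longrightarrow> mdist \<A> x y = real (d x y)"
proof -
  interpret metric_params \<delta> K c by (rule params)
  interpret X: Metric_space "mspace \<A>" "mdist \<A>" by simp
  show dist: "mdist \<A> x y = real (d x y)" if "x \<in> mspace \<A>" "y \<in> mspace \<A>" for x y
  proof -
    have "mdist \<A> x y \<in> \<int>" using \<A> that by (auto simp: metric_class_def)
    then obtain k where "mdist \<A> x y = of_int k" by (auto elim: Ints_cases)
    then show ?thesis using X.nonneg[of x y] by (simp add: d_def)
  qed
  show "bad_words bad_word {1..\<delta>} (mspace \<A>) d"
  proof
    show "finite (mspace \<A>)" using \<A> by (simp add: metric_class_def)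
    show "\<not> bad_word []" "\<not> bad_word [l, l]" for l by (auto simp: bad_word_def)
    show "bad_word (u @ w) \<Longrightarrow> bad_word u \<or> bad_word w" for u w by (rule bad_word_append)
    show "bad_word (u @ w) \<Longrightarrow> l \<in> {1..\<delta>} \<Longrightarrow> bad_word (u @ [l]) \<or> bad_word (w @ [l])" for u w l
      by (rule bad_word_chord)
    show "bad_word (u @ w) \<Longrightarrow> bad_word (w @ u)" for u w by (rule bad_word_commute)
    show "d x y = d y x" for x y by (simp add: d_def X.commute)
    show "d x y \<in> {1..\<delta>}" if "x \<in> mspace \<A>" "y \<in> mspace \<A>" "x \<noteq> y" for x y
    proof -
      have "mdist \<A> x y \<le> real \<delta>" using \<A> that by (auto simp: metric_class_def)
      moreover have "0 < mdist \<A> x y" using that by simp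
      ultimately show ?thesis using dist[OF that(1,2)] by simp
    qed
    show "\<not> bad_word [d x y, d y z, d z x]"
      if V: "x \<in> mspace \<A>" "y \<in> mspace \<A>" "z \<in> mspace \<A>" and ne: "x \<noteq> y" "y \<noteq> z" "z \<noteq> x" for x y z
    proof
      assume bad: "bad_word [d x y, d y z, d z x]"
      have dc: "d a b = d b a" for a b by (simp add: d_def X.commute)
      have tri: "d x y \<le> d y z + d z x" "d y z \<le> d x y + d z x" "d z x \<le> d x y + d y z"
        using X.triangle[OF V(1,3,2)] X.triangle[OF V(2,1,3)] X.triangle[OF V(3,2,1)]
        by (simp_all add: dist V dc flip: of_nat_add)
      have T: "triangle_in \<A> x y z" using V ne by (simp add: triangle_in_def)
      have p: "perimeter \<A> x y z = of_int (int (d x y + d y z + d z x))"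
        by (simp add: perimeter_def dist V)
      have "perimeter \<A> x y z < real (Suc c)" using \<A> T by (auto simp: metric_class_def)
      then have "d x y + d y z + d z x \<le> c" unfolding p by linarith
      moreover have "\<not> (odd (d x y + d y z + d z x) \<and> d x y + d y z + d z x < 2 * K + 1)"
      proof
        assume odd: "odd (d x y + d y z + d z x) \<and> d x y + d y z + d z x < 2 * K + 1"
        have "\<forall>u v w. \<forall>p::int. triangle_in \<A> u v w \<and> perimeter \<A> u v w = of_int p \<and> odd p
            \<longrightarrow> 2 * int K + 1 \<le> p"
          using \<A> unfolding metric_class_def mem_Collect_eq by (elim conjE)
        then have "odd (int (d x y + d y z + d z x)) \<longrightarrow> 2 * int K + 1 \<le> int (d x y + d y z + d z x)"
          using T p by blast
        then show False using odd by (simp only: even_of_nat) linarith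
      qed
      ultimately show False using bad_word_triangle[OF bad] tri by linarith
    qed
  qed simp
qed

lemma partial_automorphismD:
  assumes "partial_automorphism \<A> H H' f"
  shows "H \<subseteq> mspace \<A>" "inj_on f H" "f ` H \<subseteq> mspace \<A>"
    and "\<And>x y. x \<in> H \<Longrightarrow> y \<in> H \<Longrightarrow> mdist \<A> (f x) (f y) = mdist \<A> x y"
  using assms
  by (auto simp: partial_automorphism_def metric_isometry_def bij_betw_def Int_absorb2)

theorem theorem1p1:
  fixes \<delta> K C :: nat
  assumes "\<delta> \<ge> 2"
    and "1 \<le> K" and "K \<le> \<delta>"
    and "2 * \<delta> + K < C" and "C \<le> 3 * \<delta> + 1"
  shows "has_EPPA (metric_class \<delta> K C :: ('a::infinite) metric set)"
  unfolding has_EPPA_def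
proof
  fix \<A> :: "'a metric"
  assume \<A>: "\<A> \<in> metric_class \<delta> K C"
  \<comment> \<open>Perimeter less than \<open>C\<close> becomes perimeter at most
    \<open>c\<close>.\<close>
  define c where "c = C - 1"
  have C: "C = Suc c" using assms by (simp add: c_def)
  have params: "metric_params \<delta> K c" using assms C by unfold_locales auto
  define d where "d x y = nat \<lfloor>mdist \<A> x y\<rfloor>" for x y
  note A = metric_class_bad_words[OF params \<A>[unfolded C], folded d_def]
  interpret metric_params \<delta> K c by (rule params)
  interpret bad_words bad_word "{1..\<delta>}" "mspace \<A>" d by (rule A(1))
  \<comment> \<open>Bad words have at most \<open>c\<close> letters, so this stage excludes bad
    closed walks of every length.\<close>
  obtain V E where W: "eppa_graph (Suc c) V E (\<lambda>x. x)"
    using eppa_graph_exists infinite_UNIV by blast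
  note VE = eppa_graphD[OF W]
  interpret good_graph \<delta> K c V E
  proof
    show "\<not> bad_word (map fst p)" if "walk E x p x" for x p
      using VE(6)[OF that] bad_word_length[of "map fst p"] by auto
  qed (use VE(4) in blast)
  have "is_metric_subspace \<A> completion"
    unfolding is_metric_subspace_def mspace_completion mdist_completion
  proof (intro conjI ballI)
    show "mspace \<A> \<subseteq> V" using VE(2) by simp
    fix x y assume xy: "x \<in> mspace \<A>" "y \<in> mspace \<A>"
    show "mdist \<A> x y = real_of_int (dist_of x y)"
    proof (cases "x = y")
      case True
      then show ?thesis using xy dist_of_zero[of x y] mdist_zero[of x \<A>] by simp
    next
      case False
      then show ?thesis using A(2)[OF xy] dist_of_edge[OF VE(5)[OF xy False]] by simp
    qed
  qed
  moreover have "\<exists>g. metric_automorphism completion g \<and> (\<forall>x\<in>H. g x = f x)"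
    if pa: "partial_automorphism \<A> H H' f" for H H' f
  proof -
    note f = partial_automorphismD[OF pa]
    have "d (f x) (f y) = d x y" if "x \<in> H" "y \<in> H" for x y
      using f(4)[OF that] by (simp add: d_def)
    then obtain g where "graph_aut V E g" "\<And>x. x \<in> H \<Longrightarrow> g x = f x"
      using eppa_graph_extend[OF W f(1-3)] by blast
    then show ?thesis using completion_aut by blast
  qed
  ultimately show "\<exists>B\<in>metric_class \<delta> K C. is_metric_subspace \<A> B \<and>
      (\<forall>H H' f. partial_automorphism \<A> H H' f \<longrightarrow>
        (\<exists>g. metric_automorphism B g \<and> (\<forall>x\<in>H. g x = f x)))"
    using completion_in_class[OF VE(1)] unfolding C by blast
qed

end
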